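(* Let $\mathcal{C}=(\mathcal{M},\mathbb{V},\kappa)$ be a colored MDP over parameters $X\cup Y=\{p_1,\dots,p_k\}$, let $\nu\in\mathbb{R}$, and let $K$ be a partial assignment consisting of a literal $\textsf{viable}(p_1,\dots,p_k)$ or $\lnot\textsf{viable}(p_1,\dots,p_k)$ together with literals of the form $p_i=z$ ($z\in\mathbb{Z}$). Suppose $v:=\textsf{viable}(p_1,\dots,p_k)\in K$ and let $\eta=\{\theta\in\mathbb{V}\mid\theta\text{ satisfies }K\setminus\{v\}\}$. If $V^{\max}(\mathcal{C}[\eta])<\nu$, then $K$ is a $\mathbb{T}_\mathcal{C}$-conflict. Likewise, if $\lnot v\in K$, $\eta=\{\theta\in\mathbb{V}\mid\theta\text{ satisfies }K\setminus\{\lnot v\}\}$, and $V^{\min}(\mathcal{C}[\eta])\ge\nu$, then $K$ is a $\mathbb{T}_\mathcal{C}$-conflict.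
   Context: An MDP is a tuple $\mathcal{M}=(S,s_I,Act,\mathcal{P},R)$ with finite state set $S$, initial state $s_I$, finite action set $Act$, partial transition function $\mathcal{P}:S\times Act\rightharpoonup Distr(S)$, and state reward $R:S\to\mathbb{R}_{\ge0}$; $Act(s)=\{\alpha\mid\mathcal{P}(s,\alpha)\ne\bot\}$. A policy is $\pi:S\to Act$ with $\pi(s)\in Act(s)$; $\mathcal{M}[\pi]$ is the induced Markov chain (MC) using $\mathcal{P}(s,\pi(s))$ at each $s$. For an MC, the value $V$ is the expected total (undiscounted) reward $\sum_{i\ge0}R(s_i)$ over paths starting in $s_I$ if it exists, and $\infty$ otherwise. For an MDP, $V^{\max}(\mathcal{M})=\max_\pi V(\mathcal{M}[\pi])$ and $V^{\min}(\mathcal{M})=\min_\pi V(\mathcal{M}[\pi])$. A constrained parameter space is a finite set $\mathbb{V}\subseteq\mathbb{Z}^{X\cup Y}$ of assignments to disjoint finite variable sets $X$ (controllable) and $Y$ (uncontrollable). A colored MDP $\mathcal{C}=(\mathcal{M},\mathbb{V},\kappa)$ consists of an MDP $\mathcal{M}$, a constrained parameter space $\mathbb{V}$, and a coloring $\kappa(s,\alpha)\subseteq\mathbb{V}$ such that for every $\theta\in\mathbb{V}$ and $s\in S$ there is exactly one $\alpha\in Act(s)$ with $\theta\in\kappa(s,\alpha)$. For $\eta\subseteq\mathbb{V}$, the induced MDP $\mathcal{C}[\eta]$ is the largest sub-MDP of $\mathcal{M}$ in which every available action $\alpha$ at every state $s$ satisfies $\eta\cap\kappa(s,\alpha)\ne\emptyset$;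 $\mathcal{C}[\theta]:=\mathcal{C}[\{\theta\}]$ is an MC. The theory $\mathbb{T}_\mathcal{C}$ (for fixed $\nu$) has a $k$-ary predicate $\textsf{viable}$ with $\textsf{viable}(\theta(p_1),\dots,\theta(p_k))$ true iff $V(\mathcal{C}[\theta])\ge\nu$ and false iff $V(\mathcal{C}[\theta])<\nu$, for $\theta\in\mathbb{V}$. An assignment $\theta\in\mathbb{V}$ satisfies a set of literals $p_i=z$ if $\theta(p_i)=z$ for each of them. A partial assignment $K$ is a $\mathbb{T}_\mathcal{C}$-conflict if $K\cup\mathbb{T}_\mathcal{C}$ is inconsistent, i.e., there is no $\theta\in\mathbb{V}$ that satisfies all variable literals of $K$ and whose $\textsf{viable}$-literal in $K$ is true for $\theta$ in $\mathbb{T}_\mathcal{C}$. *)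

theory Defs
  imports "HOL-Probability.Probability"
begin

section \<open>Markov decision processes\<close>

record ('s, 'a) mdp =
  states :: "'s set"
  init :: 's
  actions :: "'a set"
  transition :: "'s \<Rightarrow> 'a \<Rightarrow> 's pmf option"
  reward :: "'s \<Rightarrow> real"

definition is_mdp :: "('s, 'a) mdp \<Rightarrow> bool" where
  "is_mdp M \<longleftrightarrow>
     finite (states M) \<and> init M \<in> states M \<and> finite (actions M) \<and>
     (\<forall>s \<alpha> \<mu>. transition M s \<alpha> = Some \<mu> \<longrightarrow>
        s \<in> states M \<and> \<alpha> \<in> actions M \<and> set_pmf \<mu> \<subseteq> states M) \<and>
     (\<forall>s\<in>states M. 0 \<le> reward M s)"

definition avail :: "('s, 'a) mdp \<Rightarrow> 's \<Rightarrow> 'a set" where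
  "avail M s = {\<alpha>. transition M s \<alpha> \<noteq> None}"

definition is_mc :: "('s, 'a) mdp \<Rightarrow> bool" where
  "is_mc M \<longleftrightarrow> is_mdp M \<and> (\<forall>s\<in>states M. \<exists>!\<alpha>. \<alpha> \<in> avail M s)"

text \<open>Policies are taken extensional, so that there are only finitely many of them.\<close>

definition policies :: "('s, 'a) mdp \<Rightarrow> ('s \<Rightarrow> 'a) set" where
  "policies M = (\<Pi>\<^sub>E s\<in>states M. avail M s)"

definition induced_mc :: "('s, 'a) mdp \<Rightarrow> ('s \<Rightarrow> 'a) \<Rightarrow> ('s, 'a) mdp" where
  "induced_mc M \<pi> = M\<lparr>transition := \<lambda>s \<alpha>. if \<alpha> = \<pi> s then transition M s \<alpha> else None\<rparr>"


section \<open>Value\<close>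

definition mc_step :: "('s, 'a) mdp \<Rightarrow> 's \<Rightarrow> 's pmf" where
  "mc_step M s = the (transition M s (THE \<alpha>. \<alpha> \<in> avail M s))"

text \<open>The conditional distribution of the state at time \<open>i\<close>, given the states at times \<open>< i\<close>.\<close>

definition path_kernel :: "('s, 'a) mdp \<Rightarrow> nat \<Rightarrow> (nat \<Rightarrow> 's) \<Rightarrow> 's measure" where
  "path_kernel M i \<omega> =
     measure_pmf (case i of 0 \<Rightarrow> return_pmf (init M) | Suc j \<Rightarrow> mc_step M (\<omega> j))"

text \<open>
  The probability measure on infinite paths given by the Ionescu-Tulcea theorem for these kernels
  (the constant \<open>PF.lim\<close> of the locale \<open>Ionescu_Tulcea\<close>, whose assumptions are verified below).
\<close>

definition paths :: "('s, 'a) mdp \<Rightarrow> (nat \<Rightarrow> 's) measure" where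
  "paths M = projective_family.lim UNIV
     (Ionescu_Tulcea.CI (path_kernel M) (\<lambda>_. count_space UNIV)) (\<lambda>_. count_space UNIV)"

text \<open>
  Rewards are nonnegative, so the nonnegative Lebesgue integral is the expectation when that
  exists and \<open>\<infinity>\<close> otherwise.
\<close>

definition mc_value :: "('s, 'a) mdp \<Rightarrow> ereal" where
  "mc_value M = enn2ereal (\<integral>\<^sup>+ \<omega>. (\<Sum>i. ennreal (reward M (\<omega> i))) \<partial>paths M)"

text \<open>Both are unspecified (\<open>Max {}\<close>, \<open>Min {}\<close>) if some state has no available action.\<close>

definition V_max :: "('s, 'a) mdp \<Rightarrow> ereal" where
  "V_max M = Max ((\<lambda>\<pi>. mc_value (induced_mc M \<pi>)) ` policies M)"

definition V_min :: "('s, 'a) mdp \<Rightarrow> ereal" where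
  "V_min M = Min ((\<lambda>\<pi>. mc_value (induced_mc M \<pi>)) ` policies M)"

lemma Ionescu_Tulcea_path_kernel: "Ionescu_Tulcea (path_kernel M) (\<lambda>_. count_space UNIV)"
proof (rule Ionescu_Tulcea.intro)
  fix i
  show "path_kernel M i \<in> measurable (PiM {0..<i} (\<lambda>_. count_space UNIV))
          (subprob_algebra (count_space UNIV))"
  proof (cases i)
    case 0
    then show ?thesis
      by (auto simp: path_kernel_def[abs_def] intro!: measurable_const measure_pmf_in_subprob_algebra)
  next
    case (Suc j)
    have "(\<lambda>\<omega>. \<omega> j) \<in> measurable (PiM {0..<i} (\<lambda>_. count_space UNIV)) (count_space UNIV)"
      by (rule measurable_component_singleton) (simp add: Suc)
    moreover have "(\<lambda>s. measure_pmf (mc_step M s)) \<in>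
        measurable (count_space UNIV) (subprob_algebra (count_space UNIV))"
      by (simp add: measure_pmf_in_subprob_algebra)
    ultimately show ?thesis
      using measurable_compose by (fastforce simp: path_kernel_def[abs_def] Suc)
  qed
qed (simp add: path_kernel_def measure_pmf.prob_space_axioms)

lemma paths_cylinder:
  fixes M :: "('s, 'a) mdp" and w :: "nat \<Rightarrow> 's"
  shows "emeasure (paths M) {\<omega>. \<forall>i\<le>n. \<omega> i = w i} =
    indicator {init M} (w 0) * (\<Prod>i<n. ennreal (pmf (mc_step M (w i)) (w (Suc i))))"
proof -
  interpret Ionescu_Tulcea "path_kernel M" "\<lambda>_. count_space UNIV :: 's measure"
    by (rule Ionescu_Tulcea_path_kernel)
  let ?N = "\<lambda>_::nat. count_space UNIV :: 's measure"
  let ?A = "\<lambda>n. PiE {0..<n} (\<lambda>i. {w i})"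
  have A: "?A n \<in> sets (PiM {0..<n} ?N)" for n
    by (rule sets_PiM_I_finite) auto
  have und: "(\<lambda>_. undefined) \<in> space (PiM {0..<0} ?N)"
    by (simp add: space_PiM)
  have C: "emeasure (C 0 (Suc n) (\<lambda>_. undefined)) (?A (Suc n)) =
    indicator {init M} (w 0) * (\<Prod>i<n. ennreal (pmf (mc_step M (w i)) (w (Suc i))))" for n
  proof -
    have eP: "emeasure (eP n \<omega>) (?A (Suc n)) =
        emeasure (path_kernel M n w) {w n} * indicator (?A n) \<omega>"
      if "\<omega> \<in> space (PiM {0..<n} ?N)" for n \<omega>
    proof -
      have ext: "\<omega> \<in> extensional {0..<n}" using that by (simp add: space_PiM PiE_def)
      have "fun_upd \<omega> n -` ?A (Suc n) = (if \<omega> \<in> ?A n then {w n} else {})"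
        using ext by (auto simp: PiE_iff extensional_def atLeast0_lessThan_Suc fun_upd_def split: if_splits)
      moreover have "path_kernel M n \<omega> = path_kernel M n w" if "\<omega> \<in> ?A n"
        using that by (auto simp: path_kernel_def PiE_iff split: nat.split)
      ultimately show ?thesis
        using emeasure_eP[OF that A[of "Suc n"]] by (simp add: indicator_def)
    qed
    have step: "emeasure (C 0 (Suc n) (\<lambda>_. undefined)) (?A (Suc n)) =
      emeasure (path_kernel M n w) {w n} * emeasure (C 0 n (\<lambda>_. undefined)) (?A n)" for n
    proof -
      have sC: "space (C 0 n (\<lambda>_. undefined)) = space (PiM {0..<n} ?N)"
        using space_C[OF und, of n] by simp
      have setC: "sets (C 0 n (\<lambda>_. undefined)) = sets (PiM {0..<n} ?N)"
        using sets_C[OF und, of n] by simp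
      have "emeasure (C 0 (Suc n) (\<lambda>_. undefined)) (?A (Suc n)) =
         (\<integral>\<^sup>+ \<omega>. emeasure (eP n \<omega>) (?A (Suc n)) \<partial>C 0 n (\<lambda>_. undefined))"
        using A[of "Suc n"] measurable_eP[of n]
        by (simp add: emeasure_bind[where N="PiM {0..<Suc n} ?N"] sC space_PiM_empty_iff
            measurable_cong_sets[OF setC refl])
      also have "\<dots> = (\<integral>\<^sup>+ \<omega>. emeasure (path_kernel M n w) {w n} * indicator (?A n) \<omega>
          \<partial>C 0 n (\<lambda>_. undefined))"
        by (rule nn_integral_cong) (simp add: eP sC)
      also have "\<dots> = emeasure (path_kernel M n w) {w n} * emeasure (C 0 n (\<lambda>_. undefined)) (?A n)"
        by (rule nn_integral_cmult_indicator) (simp add: setC A)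
      finally show ?thesis .
    qed
    have z: "emeasure (C 0 0 (\<lambda>_. undefined)) (?A 0) = 1"
      using A[of 0] by simp
    show ?thesis
    proof (induction n)
      case 0
      show ?case
        unfolding step[of 0] z
        by (auto simp: path_kernel_def emeasure_pmf_single indicator_def)
    next
      case (Suc n)
      show ?case
        unfolding step[of "Suc n"] Suc
        by (simp add: path_kernel_def emeasure_pmf_single mult_ac)
    qed
  qed
  have "{\<omega>. \<forall>i\<le>n. \<omega> i = w i} = prod_emb UNIV ?N {0..<Suc n} (?A (Suc n))"
    by (auto simp: prod_emb_def space_PiM PiE_iff less_Suc_eq_le)
  then have "emeasure (paths M) {\<omega>. \<forall>i\<le>n. \<omega> i = w i} = emeasure (CI {0..<Suc n}) (?A (Suc n))"
    using lim[OF _ A[of "Suc n"]] by (simp add: paths_def)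
  also have "\<dots> = emeasure (C 0 (Suc n) (\<lambda>_. undefined)) (?A (Suc n))"
    using emeasure_CI[OF subset_refl A[of "Suc n"]] A[of "Suc n"]
    by (simp add: prod_emb_id sets.sets_into_space)
  finally show ?thesis by (simp only: C)
qed

lemma finite_policies:
  assumes "is_mdp M" shows "finite (policies M)"
proof -
  have "finite (avail M s)" for s
    by (rule finite_subset[of _ "actions M"]) (use assms in \<open>auto simp: is_mdp_def avail_def\<close>)
  then show ?thesis
    using assms unfolding policies_def is_mdp_def by (blast intro: finite_PiE)
qed

lemma is_mc_induced_mc:
  assumes "is_mdp M" "\<pi> \<in> policies M" shows "is_mc (induced_mc M \<pi>)"
  using assms
  by (auto simp: is_mc_def is_mdp_def policies_def induced_mc_def avail_def PiE_iff split: if_splits)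


section \<open>Colored MDPs\<close>

text \<open>
  Elements of \<open>\<int>\<^bsup>X \<union> Y\<^esup>\<close> are functions extensional on \<open>X \<union> Y\<close>.
\<close>

record ('s, 'a, 'p) cmdp =
  base :: "('s, 'a) mdp"
  ctrl :: "'p set"
  unctrl :: "'p set"
  params :: "('p \<Rightarrow> int) set"
  color :: "'s \<Rightarrow> 'a \<Rightarrow> ('p \<Rightarrow> int) set"

definition is_cmdp :: "('s, 'a, 'p) cmdp \<Rightarrow> bool" where
  "is_cmdp C \<longleftrightarrow>
     is_mdp (base C) \<and>
     finite (ctrl C) \<and> finite (unctrl C) \<and> ctrl C \<inter> unctrl C = {} \<and>
     finite (params C) \<and> params C \<subseteq> (ctrl C \<union> unctrl C) \<rightarrow>\<^sub>E UNIV \<and>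
     (\<forall>s\<in>states (base C). \<forall>\<alpha>\<in>actions (base C). color C s \<alpha> \<subseteq> params C) \<and>
     (\<forall>\<theta>\<in>params C. \<forall>s\<in>states (base C). \<exists>!\<alpha>. \<alpha> \<in> avail (base C) s \<and> \<theta> \<in> color C s \<alpha>)"

definition induced_mdp :: "('s, 'a, 'p) cmdp \<Rightarrow> ('p \<Rightarrow> int) set \<Rightarrow> ('s, 'a) mdp" where
  "induced_mdp C \<eta> = (base C)
     \<lparr>transition := \<lambda>s \<alpha>. if \<eta> \<inter> color C s \<alpha> \<noteq> {} then transition (base C) s \<alpha> else None\<rparr>"

definition sub_mdp :: "('s, 'a) mdp \<Rightarrow> ('s, 'a) mdp \<Rightarrow> bool" where
  "sub_mdp M' M \<longleftrightarrow>
     is_mdp M' \<and> states M' \<subseteq> states M \<and> init M' = init M \<and> actions M' \<subseteq> actions M \<and>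
     (\<forall>s. transition M' s \<subseteq>\<^sub>m transition M s) \<and> (\<forall>s\<in>states M'. reward M' s = reward M s)"

lemma induced_mdp_largest:
  assumes "is_cmdp C"
  defines "P \<equiv> \<lambda>\<eta> M'. sub_mdp M' (base C) \<and>
     (\<forall>s\<in>states M'. \<forall>\<alpha>\<in>avail M' s. \<eta> \<inter> color C s \<alpha> \<noteq> {})"
  shows "P \<eta> (induced_mdp C \<eta>)" and "P \<eta> M' \<Longrightarrow> sub_mdp M' (induced_mdp C \<eta>)"
proof -
  show "P \<eta> (induced_mdp C \<eta>)"
    using assms(1)
    by (auto simp: P_def is_cmdp_def is_mdp_def sub_mdp_def induced_mdp_def avail_def map_le_def
        split: if_splits)
next
  assume P: "P \<eta> M'"
  then have sub: "sub_mdp M' (base C)"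
    and col: "\<And>s \<alpha>. s \<in> states M' \<Longrightarrow> \<alpha> \<in> avail M' s \<Longrightarrow> \<eta> \<inter> color C s \<alpha> \<noteq> {}"
    by (auto simp: P_def)
  have "transition M' s \<alpha> = transition (induced_mdp C \<eta>) s \<alpha>" if "transition M' s \<alpha> \<noteq> None" for s \<alpha>
  proof -
    have "s \<in> states M'" using sub that by (auto simp: sub_mdp_def is_mdp_def)
    moreover have "transition M' s \<alpha> = transition (base C) s \<alpha>"
      using sub that by (auto simp: sub_mdp_def map_le_def dom_def)
    ultimately show ?thesis
      using col[of s \<alpha>] that by (simp add: induced_mdp_def avail_def)
  qed
  then have "transition M' s \<subseteq>\<^sub>m transition (induced_mdp C \<eta>) s" for s
    by (auto simp: map_le_def dom_def simp del: not_None_eq)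
  then show "sub_mdp M' (induced_mdp C \<eta>)"
    using sub by (simp add: sub_mdp_def) (simp add: induced_mdp_def)
qed

lemma is_mc_induced_mdp:
  assumes "is_cmdp C" "\<theta> \<in> params C" shows "is_mc (induced_mdp C {\<theta>})"
proof -
  have "is_mdp (induced_mdp C {\<theta>})"
    using induced_mdp_largest(1)[OF assms(1), of "{\<theta>}"] by (simp add: sub_mdp_def)
  moreover have "avail (induced_mdp C {\<theta>}) s = {\<alpha> \<in> avail (base C) s. \<theta> \<in> color C s \<alpha>}" for s
    by (auto simp: avail_def induced_mdp_def split: if_splits)
  ultimately show ?thesis
    using assms by (simp add: is_mc_def is_cmdp_def) (simp add: induced_mdp_def)
qed


section \<open>Conflicts\<close>

text \<open>
  \<open>Viable\<close> is the atom applied to all parameters \<open>p\<^sub>1, \<dots>, p\<^sub>k\<close>; the argument tuple it denotes under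
  \<open>\<theta>\<close> is \<open>\<theta>\<close> itself, as a family indexed by the parameters.
\<close>

datatype 'p literal = Viable | NotViable | VarEq 'p int

definition viable :: "('s, 'a, 'p) cmdp \<Rightarrow> real \<Rightarrow> ('p \<Rightarrow> int) \<Rightarrow> bool" where
  "viable C \<nu> \<theta> \<longleftrightarrow> mc_value (induced_mdp C {\<theta>}) \<ge> ereal \<nu>"

definition partial_assignment :: "('s, 'a, 'p) cmdp \<Rightarrow> 'p literal set \<Rightarrow> bool" where
  "partial_assignment C K \<longleftrightarrow>
     (\<forall>p z. VarEq p z \<in> K \<longrightarrow> p \<in> ctrl C \<union> unctrl C) \<and> (Viable \<in> K \<longleftrightarrow> NotViable \<notin> K)"

definition satisfies :: "('p \<Rightarrow> int) \<Rightarrow> 'p literal set \<Rightarrow> bool" where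
  "satisfies \<theta> L \<longleftrightarrow> (\<forall>p z. VarEq p z \<in> L \<longrightarrow> \<theta> p = z)"

definition conflict :: "('s, 'a, 'p) cmdp \<Rightarrow> real \<Rightarrow> 'p literal set \<Rightarrow> bool" where
  "conflict C \<nu> K \<longleftrightarrow>
     \<not> (\<exists>\<theta>\<in>params C. satisfies \<theta> K \<and>
          (Viable \<in> K \<longrightarrow> viable C \<nu> \<theta>) \<and> (NotViable \<in> K \<longrightarrow> \<not> viable C \<nu> \<theta>))"

end

theory Submission
  imports Defs
begin

text \<open>
  An assignment \<open>\<theta> \<in> \<eta>\<close> selects exactly one action in every state, i.e. a policy of
  \<open>\<C>[\<eta>]\<close>, and this policy induces the Markov chain \<open>\<C>[\<theta>]\<close>. Hence
  \<open>V(\<C>[\<theta>])\<close> lies between the minimal and the maximal value of \<open>\<C>[\<eta>]\<close>.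
\<close>

lemma is_mdp_induced_mdp:
  assumes "is_cmdp C"
  shows "is_mdp (induced_mdp C \<eta>)"
  using induced_mdp_largest(1)[OF assms, of \<eta>] by (simp add: sub_mdp_def)

lemma assignment_policy:
  assumes C: "is_cmdp C" and \<theta>: "\<theta> \<in> params C" "\<theta> \<in> \<eta>"
  obtains \<pi> where "\<pi> \<in> policies (induced_mdp C \<eta>)"
    and "induced_mc (induced_mdp C \<eta>) \<pi> = induced_mdp C {\<theta>}"
proof
  \<comment> \<open>Restricting to the states makes \<pi> extensional, as the \<open>PiE\<close> in
    \<open>policies\<close> demands; the coloring condition makes the \<open>THE\<close> well
    defined.\<close>
  define \<pi> where "\<pi> = (\<lambda>s\<in>states (base C). THE \<alpha>. \<alpha> \<in> avail (base C) s \<and> \<theta> \<in> color C s \<alpha>)"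
  have ex1: "\<exists>!\<alpha>. \<alpha> \<in> avail (base C) s \<and> \<theta> \<in> color C s \<alpha>" if "s \<in> states (base C)" for s
    using C \<theta> that by (simp add: is_cmdp_def)
  have \<pi>: "\<pi> s \<in> avail (base C) s \<and> \<theta> \<in> color C s (\<pi> s)" if "s \<in> states (base C)" for s
    using theI'[OF ex1[OF that]] that by (simp add: \<pi>_def)
  have "\<pi> s \<in> avail (induced_mdp C \<eta>) s" if "s \<in> states (base C)" for s
    using \<pi>[OF that] \<theta>(2) by (auto simp: avail_def induced_mdp_def)
  moreover have "states (induced_mdp C \<eta>) = states (base C)"
    by (simp add: induced_mdp_def)
  ultimately show "\<pi> \<in> policies (induced_mdp C \<eta>)"
    by (auto simp: policies_def PiE_iff \<pi>_def)
  \<comment> \<open>Both records are \<open>base C\<close> with only the \<open>transition\<close>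
    field updated, so comparing transition functions suffices.\<close>
  have "transition (induced_mc (induced_mdp C \<eta>) \<pi>) s \<alpha> = transition (induced_mdp C {\<theta>}) s \<alpha>" for s \<alpha>
  proof (cases "transition (base C) s \<alpha>")
    case None
    then show ?thesis by (auto simp: induced_mc_def induced_mdp_def)
  next
    case (Some \<mu>)
    then have s: "s \<in> states (base C)"
      using C unfolding is_cmdp_def is_mdp_def by blast
    \<comment> \<open>Since \<alpha> is available at \<open>s\<close>, uniqueness of the
      \<theta>-colored action forces it to be \<open>\<pi> s\<close>.\<close>
    have "\<alpha> = \<pi> s \<longleftrightarrow> \<theta> \<in> color C s \<alpha>"
      using ex1[OF s] \<pi>[OF s] Some unfolding avail_def by blast
    \<comment> \<open>As \<theta> \<in> \<eta>, every action kept by the filter for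
      \<open>{\<theta>}\<close> is also kept by the one for \<eta>.\<close>
    then show ?thesis
      using \<theta>(2) by (auto simp: induced_mc_def induced_mdp_def)
  qed
  then show "induced_mc (induced_mdp C \<eta>) \<pi> = induced_mdp C {\<theta>}"
    by (simp add: induced_mc_def induced_mdp_def fun_eq_iff)
qed

text \<open>There are finitely many policies, so \<open>Max\<close> and \<open>Min\<close> bound
  every member of the value set. The assumption \<theta> \<in> \<eta> provides such a member, which
  rules out the unspecified \<open>Max {}\<close> and \<open>Min {}\<close>.\<close>

lemma mc_value_between_V_min_V_max:
  assumes C: "is_cmdp C" and \<theta>: "\<theta> \<in> params C" "\<theta> \<in> \<eta>"
  shows "V_min (induced_mdp C \<eta>) \<le> mc_value (induced_mdp C {\<theta>})"
    and "mc_value (induced_mdp C {\<theta>}) \<le> V_max (induced_mdp C \<eta>)"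
proof -
  let ?V = "(\<lambda>\<pi>. mc_value (induced_mc (induced_mdp C \<eta>) \<pi>)) ` policies (induced_mdp C \<eta>)"
  have "finite ?V"
    using finite_policies[OF is_mdp_induced_mdp[OF C]] by simp
  moreover have "mc_value (induced_mdp C {\<theta>}) \<in> ?V"
    using assignment_policy[OF assms] by (metis image_eqI)
  ultimately show "V_min (induced_mdp C \<eta>) \<le> mc_value (induced_mdp C {\<theta>})"
    and "mc_value (induced_mdp C {\<theta>}) \<le> V_max (induced_mdp C \<eta>)"
    unfolding V_min_def V_max_def by (rule Min_le, rule Max_ge)
qed

theorem theorem2:
  fixes C :: "('s, 'a, 'p) cmdp" and \<nu> :: real and K :: "'p literal set"
  assumes "is_cmdp C" and "partial_assignment C K"
  shows "(Viable \<in> K \<longrightarrow>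
            (\<forall>\<eta>. \<eta> = {\<theta> \<in> params C. satisfies \<theta> (K - {Viable})} \<longrightarrow>
              V_max (induced_mdp C \<eta>) < ereal \<nu> \<longrightarrow> conflict C \<nu> K)) \<and>
         (NotViable \<in> K \<longrightarrow>
            (\<forall>\<eta>. \<eta> = {\<theta> \<in> params C. satisfies \<theta> (K - {NotViable})} \<longrightarrow>
              V_min (induced_mdp C \<eta>) \<ge> ereal \<nu> \<longrightarrow> conflict C \<nu> K))"
proof (intro conjI impI allI)
  fix \<eta>
  assume K: "Viable \<in> K" and \<eta>: "\<eta> = {\<theta> \<in> params C. satisfies \<theta> (K - {Viable})}"
    and less: "V_max (induced_mdp C \<eta>) < ereal \<nu>"
  \<comment> \<open>If \<eta> is empty, \<open>V_max\<close> is unspecified, but then no \<theta>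
    satisfies the equations and the claim is vacuous.\<close>
  have "\<not> viable C \<nu> \<theta>" if "\<theta> \<in> params C" "satisfies \<theta> K" for \<theta>
  proof -
    have "\<theta> \<in> \<eta>" using that by (simp add: \<eta> satisfies_def)
    from mc_value_between_V_min_V_max(2)[OF assms(1) that(1) this] less
    show ?thesis by (simp add: viable_def not_le)
  qed
  then show "conflict C \<nu> K" using K by (auto simp: conflict_def)
next
  fix \<eta>
  assume K: "NotViable \<in> K" and \<eta>: "\<eta> = {\<theta> \<in> params C. satisfies \<theta> (K - {NotViable})}"
    and le: "V_min (induced_mdp C \<eta>) \<ge> ereal \<nu>"
  have "viable C \<nu> \<theta>" if "\<theta> \<in> params C" "satisfies \<theta> K" for \<theta>
  proof -
    \<comment> \<open>\<open>satisfies\<close> reads only \<open>VarEq\<close> literals, so removing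
      \<open>NotViable\<close> changes nothing.\<close>
    have "\<theta> \<in> \<eta>" using that by (simp add: \<eta> satisfies_def)
    from le mc_value_between_V_min_V_max(1)[OF assms(1) that(1) this]
    show ?thesis unfolding viable_def by (rule order_trans)
  qed
  then show "conflict C \<nu> K" using K by (auto simp: conflict_def)
qed

end
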